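(* Let $n\ge1$. In the group algebra $\mathbb C[\mathfrak S_n]$ the following identities hold: $$u_{\widetilde{\mathrm{maj}}}*u_{\widetilde{\mathrm{des}}}=-(n-1)!\cdot u_{\widetilde{\mathrm{maj}}},\qquad u_{\widetilde{\mathrm{maj}}}*u_{\widetilde{\mathrm{maj}}}=-\frac{n!}2\cdot u_{\widetilde{\mathrm{maj}}},$$ $$u_{\widetilde{\mathrm{des}}}*u_{\widetilde{\mathrm{des}}}=-(n-1)!\cdot u_{\widetilde{\mathrm{des}}},\qquad u_{\widetilde{\mathrm{des}}}*u_{\widetilde{\mathrm{maj}}}=-\frac{n!}2\cdot u_{\widetilde{\mathrm{des}}},$$ $$u_{\widetilde{\mathrm{inv}}}*u_{\widetilde{\mathrm{des}}}=-(n-1)!\cdot u_{\widetilde{\mathrm{inv}}},\qquad u_{\widetilde{\mathrm{inv}}}*u_{\widetilde{\mathrm{maj}}}=-\frac{n!}2\cdot u_{\widetilde{\mathrm{inv}}},$$ or, explicitly, for every $\sigma\in\mathfrak S_n$, $$\sum_{g\in\mathfrak S_n}\widetilde{\mathrm{maj}}(g)\,\widetilde{\mathrm{des}}(g^{-1}\sigma)=-(n-1)!\cdot\widetilde{\mathrm{maj}}(\sigma),$$ and similarly for all the other convolutions. In particular, $u_{\widetilde{\mathrm{des}}}$ and $u_{\widetilde{\mathrm{maj}}}$ are, up to normalization by a nonzero scalar, idempotents in $\mathbb C[\mathfrak S_n]$.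
   Context: $\mathfrak S_n$ is the symmetric group on $\{1,\dots,n\}$, with products taken left to right: $(\sigma\tau)(i)=\tau(\sigma(i))$. For $\sigma\in\mathfrak S_n$: $\mathrm{Des}(\sigma)=\{i\in\{1,\dots,n-1\}:\sigma(i)>\sigma(i+1)\}$, $\mathrm{des}(\sigma)=\#\mathrm{Des}(\sigma)$, $\mathrm{maj}(\sigma)=\sum_{i\in\mathrm{Des}(\sigma)}i$, $\mathrm{inv}(\sigma)=\#\{i<j:\sigma(i)>\sigma(j)\}$. The centered statistics are $\widetilde{\mathrm{des}}(\sigma)=\mathrm{des}(\sigma)-\frac{n-1}2$, $\widetilde{\mathrm{maj}}(\sigma)=\mathrm{maj}(\sigma)-\frac{n(n-1)}4$, $\widetilde{\mathrm{inv}}(\sigma)=\mathrm{inv}(\sigma)-\frac{n(n-1)}4$, and $u_{\widetilde\varepsilon}=\sum_{\sigma\in\mathfrak S_n}\widetilde\varepsilon(\sigma)\sigma\in\mathbb C[\mathfrak S_n]$ for $\varepsilon=\mathrm{des},\mathrm{maj},\mathrm{inv}$. The symbol $*$ is multiplication (convolution) in $\mathbb C[\mathfrak S_n]$: $(a*b)(\sigma)=\sum_{g\in\mathfrak S_n}a(g)b(g^{-1}\sigma)$. *)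

theory Defs
  imports Complex_Main "HOL-Combinatorics.Permutations"
begin

definition Sym :: "nat \<Rightarrow> (nat \<Rightarrow> nat) set" where
  "Sym n = {\<sigma>. \<sigma> permutes {1..n}}"

(* Products are taken left to right, opposite to function composition. *)
definition perm_mult :: "(nat \<Rightarrow> nat) \<Rightarrow> (nat \<Rightarrow> nat) \<Rightarrow> nat \<Rightarrow> nat"  (infixl "\<cdot>" 70) where
  "\<sigma> \<cdot> \<tau> = (\<lambda>i. \<tau> (\<sigma> i))"

definition Des :: "nat \<Rightarrow> (nat \<Rightarrow> nat) \<Rightarrow> nat set" where
  "Des n \<sigma> = {i \<in> {1..<n}. \<sigma> i > \<sigma> (i + 1)}"

definition des :: "nat \<Rightarrow> (nat \<Rightarrow> nat) \<Rightarrow> nat" where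
  "des n \<sigma> = card (Des n \<sigma>)"

definition maj :: "nat \<Rightarrow> (nat \<Rightarrow> nat) \<Rightarrow> nat" where
  "maj n \<sigma> = (\<Sum>i\<in>Des n \<sigma>. i)"

(* The inversion statistic; the name inv is taken by the inverse function. *)
definition invs :: "nat \<Rightarrow> (nat \<Rightarrow> nat) \<Rightarrow> nat" where
  "invs n \<sigma> = card {(i, j). i \<in> {1..n} \<and> j \<in> {1..n} \<and> i < j \<and> \<sigma> i > \<sigma> j}"

definition cdes :: "nat \<Rightarrow> (nat \<Rightarrow> nat) \<Rightarrow> real" where
  "cdes n \<sigma> = real (des n \<sigma>) - (real n - 1) / 2"

definition cmaj :: "nat \<Rightarrow> (nat \<Rightarrow> nat) \<Rightarrow> real" where
  "cmaj n \<sigma> = real (maj n \<sigma>) - real n * (real n - 1) / 4"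

definition cinv :: "nat \<Rightarrow> (nat \<Rightarrow> nat) \<Rightarrow> real" where
  "cinv n \<sigma> = real (invs n \<sigma>) - real n * (real n - 1) / 4"

(* An element of the complex group algebra of Sym n is represented by its coefficient
   function, extended by 0 outside Sym n, so that equality of elements is equality of
   functions. *)
definition group_algebra :: "nat \<Rightarrow> ((nat \<Rightarrow> nat) \<Rightarrow> complex) set" where
  "group_algebra n = {a. \<forall>\<sigma>. \<sigma> \<notin> Sym n \<longrightarrow> a \<sigma> = 0}"

definition conv ::
  "nat \<Rightarrow> ((nat \<Rightarrow> nat) \<Rightarrow> complex) \<Rightarrow> ((nat \<Rightarrow> nat) \<Rightarrow> complex) \<Rightarrow> (nat \<Rightarrow> nat) \<Rightarrow> complex" where
  "conv n a b = (\<lambda>\<sigma>. if \<sigma> \<in> Sym n then (\<Sum>g\<in>Sym n. a g * b (inv g \<cdot> \<sigma>)) else 0)"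

definition scale :: "complex \<Rightarrow> ((nat \<Rightarrow> nat) \<Rightarrow> complex) \<Rightarrow> (nat \<Rightarrow> nat) \<Rightarrow> complex" where
  "scale c a = (\<lambda>\<sigma>. c * a \<sigma>)"

(* The element of the group algebra in which each permutation s of Sym n has
   coefficient f s. *)
definition stat_elem :: "nat \<Rightarrow> ((nat \<Rightarrow> nat) \<Rightarrow> real) \<Rightarrow> (nat \<Rightarrow> nat) \<Rightarrow> complex" where
  "stat_elem n f = (\<lambda>\<sigma>. if \<sigma> \<in> Sym n then complex_of_real (f \<sigma>) else 0)"

definition u_des :: "nat \<Rightarrow> (nat \<Rightarrow> nat) \<Rightarrow> complex" where
  "u_des n = stat_elem n (cdes n)"

definition u_maj :: "nat \<Rightarrow> (nat \<Rightarrow> nat) \<Rightarrow> complex" where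
  "u_maj n = stat_elem n (cmaj n)"

definition u_inv :: "nat \<Rightarrow> (nat \<Rightarrow> nat) \<Rightarrow> complex" where
  "u_inv n = stat_elem n (cinv n)"

definition idempotent_elem :: "nat \<Rightarrow> ((nat \<Rightarrow> nat) \<Rightarrow> complex) \<Rightarrow> bool" where
  "idempotent_elem n e \<longleftrightarrow> e \<in> group_algebra n \<and> conv n e e = e"

end

theory Submission
  imports Defs
begin

text \<open>Each centered statistic is a linear combination of centered inversion indicators
  \<open>\<plusminus>1/2\<close>, so it suffices to convolve the indicator of the positions \<open>i, j\<close> with that of
  the adjacent positions \<open>k, k + 1\<close>. Swapping the values \<open>k\<close> and \<open>k + 1\<close> of \<open>g\<close> flips the
  second factor, and changes the first one only if \<open>{g i, g j} = {k, k + 1}\<close>; hence only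
  these \<open>2 (n - 2)!\<close> permutations contribute, and each of them contributes \<open>- 1/2\<close> times the
  indicator of \<open>\<sigma>\<close> at \<open>i, j\<close>. The result does not depend on \<open>k\<close>, so every linear
  combination of indicators is an eigenvector under convolution with \<open>des\<close> and \<open>maj\<close>.\<close>

section \<open>Permutations with two prescribed values\<close>

lemma card_permutes_two_fixed_values:
  assumes S: "finite S" and ij: "i \<in> S" "j \<in> S" "i \<noteq> j" and ab: "a \<in> S" "b \<in> S" "a \<noteq> b"
  shows "card {g. g permutes S \<and> g i = a \<and> g j = b} = fact (card S - 2)"
proof -
  \<comment> \<open>\<open>b'\<close> is the preimage of \<open>b\<close> under the outer
    transposition. The inner one fixes \<open>i\<close>, since \<open>b' \<noteq> i\<close>, and
    sends \<open>j\<close> to \<open>b'\<close>; so \<open>t\<close> sends \<open>i\<close> to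
    \<open>a\<close> and \<open>j\<close> to \<open>b\<close>.\<close>
  define b' where "b' = transpose i a b"
  define t where "t = transpose i a \<circ> transpose j b'"
  have b': "b' \<noteq> i" "b' \<in> S"
    using ij ab unfolding b'_def by (auto simp: transpose_def)
  have t: "t permutes S" "t i = a" "t j = b"
    using ij ab b' unfolding t_def
    by (auto intro!: permutes_compose permutes_swap_id) (auto simp: b'_def transpose_def)
  \<comment> \<open>Composing with \<open>t\<close> turns the fixed values \<open>i\<close>,
    \<open>j\<close> into \<open>a\<close>, \<open>b\<close>, which reduces the count to the
    permutations that fix both \<open>i\<close> and \<open>j\<close>.\<close>
  have "bij_betw ((\<circ>) t) {p. p permutes S - {i, j}} {g. g permutes S \<and> g i = a \<and> g j = b}"
  proof (rule bij_betw_byWitness[where f' = "(\<circ>) (inv t)"])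
    show "\<forall>p\<in>{p. p permutes S - {i, j}}. inv t \<circ> (t \<circ> p) = p"
      using permutes_inv_o(2)[OF t(1)] by (simp add: o_assoc)
    show "\<forall>g\<in>{g. g permutes S \<and> g i = a \<and> g j = b}. t \<circ> (inv t \<circ> g) = g"
      using permutes_inv_o(1)[OF t(1)] by (simp add: o_assoc)
    show "(\<circ>) t ` {p. p permutes S - {i, j}} \<subseteq> {g. g permutes S \<and> g i = a \<and> g j = b}"
    proof clarify
      fix p assume p: "p permutes S - {i, j}"
      then have "p i = i" "p j = j" by (auto simp: permutes_def)
      moreover have "t \<circ> p permutes S"
        using permutes_compose[OF permutes_subset[OF p] t(1)] by auto
      ultimately show "t \<circ> p permutes S \<and> (t \<circ> p) i = a \<and> (t \<circ> p) j = b"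
        using t by simp
    qed
    show "(\<circ>) (inv t) ` {g. g permutes S \<and> g i = a \<and> g j = b} \<subseteq> {p. p permutes S - {i, j}}"
    proof clarify
      fix g assume g: "g permutes S" "a = g i" "b = g j"
      have "inv t (g i) = i" "inv t (g j) = j"
        using t g permutes_inverses(2)[OF t(1)] by metis+
      then show "inv t \<circ> g permutes S - {i, j}"
        by (intro permutes_superset[OF permutes_compose[OF g(1) permutes_inv[OF t(1)]]]) auto
    qed
  qed
  then have "card {g. g permutes S \<and> g i = a \<and> g j = b} = card {p. p permutes S - {i, j}}"
    by (simp add: bij_betw_same_card)
  also have "\<dots> = fact (card (S - {i, j}))"
    using S by (simp add: card_permutations)
  also have "card (S - {i, j}) = card S - 2"
    using ij by (subst card_Diff_subset) auto
  finally show ?thesis .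
qed

section \<open>Convolution of two centered inversion indicators\<close>

lemma finite_Sym: "finite (Sym n)"
  unfolding Sym_def by (rule finite_permutations) simp

lemma inv_perm_mult_in_Sym: "g \<in> Sym n \<Longrightarrow> \<sigma> \<in> Sym n \<Longrightarrow> inv g \<cdot> \<sigma> \<in> Sym n"
  unfolding Sym_def perm_mult_def
  using permutes_compose[of "inv g" "{1..n}" \<sigma>] permutes_inv by (auto simp: o_def)

text \<open>With the values 1/2 and -1/2, exchanging two distinct values is a change of sign. A tie
  counts as -1/2, but cannot occur for a permutation and \<open>i \<noteq> j\<close>.\<close>

definition cinv_at :: "nat \<Rightarrow> nat \<Rightarrow> (nat \<Rightarrow> nat) \<Rightarrow> real" where
  "cinv_at i j g = (if g i > g j then 1 / 2 else - 1 / 2)"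

lemma cinv_at_eq: "cinv_at i j g = of_bool (g i > g j) - 1 / 2"
  by (simp add: cinv_at_def)

lemma cinv_at_convolution:
  assumes \<sigma>: "\<sigma> \<in> Sym n" and k: "k \<in> {1..<n}"
    and ij: "i \<in> {1..n}" "j \<in> {1..n}" "i \<noteq> j"
  shows "(\<Sum>g\<in>Sym n. cinv_at i j g * cinv_at k (k + 1) (inv g \<cdot> \<sigma>)) =
    - fact (n - 2) * cinv_at i j \<sigma>"
proof -
  define t where "t = transpose k (k + 1)"
  define F where "F g = cinv_at i j g * cinv_at k (k + 1) (inv g \<cdot> \<sigma>)" for g
  define A where "A a b = {g \<in> Sym n. g i = a \<and> g j = b}" for a b
  have t: "t permutes {1..n}"
    using k unfolding t_def by (intro permutes_swap_id) auto
  have tt: "t (t x) = x" for x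
    by (simp add: t_def)
  \<comment> \<open>Composition with the involution \<open>t\<close> permutes \<open>Sym n\<close>,
    so the sum may be evaluated over the pairs of \<open>g\<close> and
    \<open>t \<circ> g\<close>.\<close>
  have swapped: "(\<Sum>g\<in>Sym n. F (t \<circ> g)) = (\<Sum>g\<in>Sym n. F g)"
    using permutes_compose[OF _ t]
    by (intro sum.reindex_bij_witness[where i = "(\<circ>) t" and j = "(\<circ>) t"])
      (auto simp: Sym_def fun_eq_iff tt)
  have pair: "F g + F (t \<circ> g) =
      - cinv_at i j \<sigma> * (of_bool (g \<in> A k (k + 1)) + of_bool (g \<in> A (k + 1) k))"
    if g: "g \<in> Sym n" for g
  proof -
    have gp: "g permutes {1..n}" and \<sigma>p: "\<sigma> permutes {1..n}"
      using g \<sigma> by (auto simp: Sym_def)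
    \<comment> \<open>Swapping values of \<open>g\<close> swaps positions of \<open>inv g\<close>,
      so the second factor compares the same two distinct values of \<open>\<sigma>\<close> in the
      opposite order.\<close>
    have inv_tg: "inv (t \<circ> g) = inv g \<circ> t"
    proof (rule inv_unique_comp)
      show "t \<circ> g \<circ> (inv g \<circ> t) = id"
        using permutes_inverses(1)[OF gp] by (simp add: fun_eq_iff tt)
      show "inv g \<circ> t \<circ> (t \<circ> g) = id"
        using permutes_inverses(2)[OF gp] by (simp add: fun_eq_iff tt)
    qed
    have "inv g k \<noteq> inv g (k + 1)"
      using permutes_inverses(1)[OF gp] by (metis n_not_Suc_n Suc_eq_plus1)
    then have "\<sigma> (inv g k) \<noteq> \<sigma> (inv g (k + 1))"
      using permutes_inj[OF \<sigma>p] by (auto dest: injD)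
    then have flip: "cinv_at k (k + 1) (inv (t \<circ> g) \<cdot> \<sigma>) = - cinv_at k (k + 1) (inv g \<cdot> \<sigma>)"
      unfolding inv_tg by (auto simp: cinv_at_def perm_mult_def t_def)
    have gij: "g i \<noteq> g j"
      using ij permutes_inj[OF gp] by (auto dest: injD)
    have \<sigma>ij: "\<sigma> i \<noteq> \<sigma> j"
      using ij permutes_inj[OF \<sigma>p] by (auto dest: injD)
    consider "g i = k \<and> g j = k + 1" | "g i = k + 1 \<and> g j = k"
      | "\<not> (g i = k \<and> g j = k + 1)" "\<not> (g i = k + 1 \<and> g j = k)" by blast
    then show ?thesis
    proof cases
      \<comment> \<open>At \<open>g\<close> the first factor is -1/2 and the second is
        \<open>cinv_at i j \<sigma>\<close>. At \<open>t \<circ> g\<close> both change sign, so the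
        two products are equal.\<close>
      case 1
      then have "inv g k = i" "inv g (k + 1) = j"
        using permutes_inverses(2)[OF gp] by metis+
      with 1 flip g show ?thesis
        by (auto simp: F_def A_def cinv_at_def perm_mult_def t_def)
    next
      \<comment> \<open>Now the first factor is 1/2 and the second compares
        \<open>\<sigma> j\<close> with \<open>\<sigma> i\<close>; as these differ, it is
        \<open>- cinv_at i j \<sigma>\<close>, and the product is the same as before.\<close>
      case 2
      then have "inv g k = j" "inv g (k + 1) = i"
        using permutes_inverses(2)[OF gp] by metis+
      with 2 flip g \<sigma>ij show ?thesis
        by (auto simp: F_def A_def cinv_at_def perm_mult_def t_def)
    next
      case 3
      \<comment> \<open>\<open>t\<close> exchanges consecutive integers and so preserves the order
        of every other pair. Only the second factor changes sign, and the two products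
        cancel.\<close>
      with gij have "(g i > g j) = (t (g i) > t (g j))"
        unfolding t_def transpose_def by auto
      then have "cinv_at i j (t \<circ> g) = cinv_at i j g"
        by (simp add: cinv_at_def)
      moreover have "g \<notin> A k (k + 1)" "g \<notin> A (k + 1) k"
        using 3 by (auto simp: A_def)
      ultimately show ?thesis
        using flip by (simp add: F_def)
    qed
  qed
  have cardA: "(\<Sum>g\<in>Sym n. of_bool (g \<in> A a b)) = (fact (n - 2) :: real)"
    if "a \<in> {1..n}" "b \<in> {1..n}" "a \<noteq> b" for a b
  proof -
    have "A a b = {g. g permutes {1..n} \<and> g i = a \<and> g j = b}"
      by (auto simp: A_def Sym_def)
    then have "card (A a b) = fact (n - 2)"
      using card_permutes_two_fixed_values[OF _ ij that] by simp
    moreover have "(\<Sum>g\<in>Sym n. of_bool (g \<in> A a b)) = real (card (A a b))"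
      using finite_Sym by (simp add: A_def Int_def)
    ultimately show ?thesis by simp
  qed
  have "2 * (\<Sum>g\<in>Sym n. F g) = (\<Sum>g\<in>Sym n. F g + F (t \<circ> g))"
    by (simp add: sum.distrib swapped)
  also have "\<dots> = - cinv_at i j \<sigma> * (fact (n - 2) + fact (n - 2))"
    using k cardA by (simp add: pair sum.distrib flip: sum_distrib_left del: mult_minus_left)
  also have "\<dots> = 2 * (- fact (n - 2) * cinv_at i j \<sigma>)"
    by (simp only: mult_2[symmetric] mult_ac mult_minus_left mult_minus_right)
  finally have "(\<Sum>g\<in>Sym n. F g) = - fact (n - 2) * cinv_at i j \<sigma>"
    by (simp only: mult_cancel_left) simp
  then show ?thesis
    unfolding F_def .
qed

section \<open>The centered statistics as weighted sums of indicators\<close>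

lemma cdes_eq: "n \<ge> 1 \<Longrightarrow> cdes n g = (\<Sum>k\<in>{1..<n}. 1 * cinv_at k (k + 1) g)"
  \<comment> \<open>The \<open>n - 1\<close> adjacent positions contribute 1/2 each to the
    centering. The explicit weight 1 gives the shape of a weighted sum that the convolution formula
    matches.\<close>
  by (simp add: cdes_def des_def Des_def cinv_at_eq sum_subtractf Int_def of_nat_diff)

lemma sum_positions: "n \<ge> 1 \<Longrightarrow> (\<Sum>k\<in>{1..<n}. real k) = real n * (real n - 1) / 2"
  by (induction n rule: dec_induct) (simp_all add: sum.atLeastLessThan_Suc field_simps)

text \<open>The centering constant is half the sum of the positions 1, ...,
  \<open>n - 1\<close>.\<close>

lemma cmaj_eq:
  assumes "n \<ge> 1"
  shows "cmaj n g = (\<Sum>k\<in>{1..<n}. real k * cinv_at k (k + 1) g)"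
proof -
  have "(\<Sum>k\<in>{1..<n}. real k * cinv_at k (k + 1) g) =
      (\<Sum>k\<in>{1..<n}. if g (k + 1) < g k then real k else 0) - (\<Sum>k\<in>{1..<n}. real k) / 2"
    unfolding sum_divide_distrib sum_subtractf[symmetric]
    by (intro sum.cong) (auto simp: cinv_at_def)
  also have "(\<Sum>k\<in>{1..<n}. if g (k + 1) < g k then real k else 0) = real (maj n g)"
    unfolding maj_def Des_def by (subst sum.inter_filter[symmetric]) auto
  finally show ?thesis
    unfolding cmaj_def sum_positions[OF assms] by simp
qed

definition pos_pairs :: "nat \<Rightarrow> (nat \<times> nat) set" where
  "pos_pairs n = {(i, j). i \<in> {1..n} \<and> j \<in> {1..n} \<and> i < j}"

lemma finite_pos_pairs: "finite (pos_pairs n)"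
  by (rule finite_subset[of _ "{1..n} \<times> {1..n}"]) (auto simp: pos_pairs_def)

lemma card_pos_pairs: "real (card (pos_pairs n)) = real n * (real n - 1) / 2"
proof (induction n)
  case (Suc n)
  \<comment> \<open>The new pairs are those ending in the last position.\<close>
  have "pos_pairs (Suc n) = pos_pairs n \<union> (\<lambda>i. (i, Suc n)) ` {1..n}"
    by (auto simp: pos_pairs_def le_Suc_eq)
  moreover have "card (pos_pairs n \<union> (\<lambda>i. (i, Suc n)) ` {1..n}) = card (pos_pairs n) + n"
    by (subst card_Un_disjoint)
      (auto simp: finite_pos_pairs card_image inj_on_def, auto simp: pos_pairs_def)
  ultimately show ?case
    using Suc by (simp add: field_simps)
qed (auto simp: pos_pairs_def)

text \<open>The centering constant is half the number of position pairs.\<close>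

lemma cinv_eq: "cinv n g = (\<Sum>p\<in>pos_pairs n. 1 * cinv_at (fst p) (snd p) g)"
proof -
  have "{(i, j). i \<in> {1..n} \<and> j \<in> {1..n} \<and> i < j \<and> g i > g j} =
      pos_pairs n \<inter> {p. g (fst p) > g (snd p)}"
    by (auto simp: pos_pairs_def)
  then show ?thesis
    by (simp add: cinv_def invs_def cinv_at_eq sum_subtractf finite_pos_pairs card_pos_pairs)
qed

section \<open>Eigenvalues for linear combinations of indicators\<close>

lemma cinv_at_combination_convolution:
  assumes "\<sigma> \<in> Sym n"
    and ab: "\<And>x. x \<in> X \<Longrightarrow> a x \<in> {1..n} \<and> b x \<in> {1..n} \<and> a x \<noteq> b x"
  shows "(\<Sum>g\<in>Sym n. (\<Sum>x\<in>X. w x * cinv_at (a x) (b x) g) *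
      (\<Sum>k\<in>{1..<n}. v k * cinv_at k (k + 1) (inv g \<cdot> \<sigma>))) =
    - (fact (n - 2) * (\<Sum>k\<in>{1..<n}. v k)) * (\<Sum>x\<in>X. w x * cinv_at (a x) (b x) \<sigma>)"
    (is "?L = ?R")
proof -
  have "?L = (\<Sum>x\<in>X. \<Sum>k\<in>{1..<n}. w x * v k *
      (\<Sum>g\<in>Sym n. cinv_at (a x) (b x) g * cinv_at k (k + 1) (inv g \<cdot> \<sigma>)))"
    unfolding sum_product
    by (subst sum.swap, rule sum.cong[OF refl], subst sum.swap)
      (auto simp: sum_distrib_left mult_ac intro!: sum.cong)
  also have "\<dots> = (\<Sum>x\<in>X. \<Sum>k\<in>{1..<n}. w x * v k * (- fact (n - 2) * cinv_at (a x) (b x) \<sigma>))"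
    using cinv_at_convolution[OF assms(1)] ab by (intro sum.cong refl) (simp del: One_nat_def)
  \<comment> \<open>The inner convolution no longer depends on \<open>k\<close>, so the double sum
    factors and \<open>v\<close> enters only through its total weight.\<close>
  also have "\<dots> = (\<Sum>x\<in>X. w x * cinv_at (a x) (b x) \<sigma>) *
      (\<Sum>k\<in>{1..<n}. v k) * (- fact (n - 2))"
    unfolding sum_product unfolding sum_distrib_right
    by (intro sum.cong refl) (simp add: mult_ac)
  finally show ?thesis
    by simp
qed

text \<open>This is the common class containing all three statistics; its members serve as the left
  factors of the convolutions.\<close>

definition cinv_at_combination :: "nat \<Rightarrow> ((nat \<Rightarrow> nat) \<Rightarrow> real) \<Rightarrow> bool" where
  "cinv_at_combination n f \<longleftrightarrow> (\<exists>(X :: (nat \<times> nat) set) w.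
    X \<subseteq> {1..n} \<times> {1..n} \<and> (\<forall>x\<in>X. fst x \<noteq> snd x) \<and>
    f = (\<lambda>g. \<Sum>x\<in>X. w x * cinv_at (fst x) (snd x) g))"

lemma cinv_at_combination_adjacent:
  "cinv_at_combination n (\<lambda>g. \<Sum>k\<in>{1..<n}. v k * cinv_at k (k + 1) g)"
  unfolding cinv_at_combination_def
  by (rule exI[of _ "(\<lambda>k. (k, k + 1)) ` {1..<n}"], rule exI[of _ "v \<circ> fst"])
    (auto simp: sum.reindex inj_on_def)

lemma cinv_at_combination_cdes: "n \<ge> 1 \<Longrightarrow> cinv_at_combination n (cdes n)"
  by (subst ext[OF cdes_eq]) (assumption, rule cinv_at_combination_adjacent)

lemma cinv_at_combination_cmaj: "n \<ge> 1 \<Longrightarrow> cinv_at_combination n (cmaj n)"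
  by (subst ext[OF cmaj_eq]) (assumption, rule cinv_at_combination_adjacent)

lemma cinv_at_combination_cinv: "cinv_at_combination n (cinv n)"
  unfolding cinv_at_combination_def
  by (rule exI[of _ "pos_pairs n"], rule exI[of _ "\<lambda>_. 1"])
    (auto simp: cinv_eq[abs_def] pos_pairs_def)

text \<open>The total weights are \<open>n - 1\<close> for \<open>des\<close> and
  \<open>n (n - 1) / 2\<close> for \<open>maj\<close>; multiplied by \<open>(n - 2)!\<close> they
  give \<open>(n - 1)!\<close> and \<open>n! / 2\<close>.\<close>

lemma combination_convolution:
  assumes n: "n \<ge> 1" and f: "cinv_at_combination n f" and \<sigma>: "\<sigma> \<in> Sym n"
  shows combination_cdes: "(\<Sum>g\<in>Sym n. f g * cdes n (inv g \<cdot> \<sigma>)) = - fact (n - 1) * f \<sigma>"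
    and combination_cmaj: "(\<Sum>g\<in>Sym n. f g * cmaj n (inv g \<cdot> \<sigma>)) = - (fact n / 2) * f \<sigma>"
proof -
  obtain X :: "(nat \<times> nat) set" and w where X: "X \<subseteq> {1..n} \<times> {1..n}" "\<forall>x\<in>X. fst x \<noteq> snd x"
    and f_eq: "f = (\<lambda>g. \<Sum>x\<in>X. w x * cinv_at (fst x) (snd x) g)"
    using f unfolding cinv_at_combination_def by blast
  have conv_eq: "(\<Sum>g\<in>Sym n. f g * (\<Sum>k\<in>{1..<n}. v k * cinv_at k (k + 1) (inv g \<cdot> \<sigma>))) =
      - (fact (n - 2) * (\<Sum>k\<in>{1..<n}. v k)) * f \<sigma>" for v
    unfolding f_eq using X by (intro cinv_at_combination_convolution[OF \<sigma>]) auto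
  \<comment> \<open>For \<open>n = 1\<close> the truncated \<open>n - 2\<close> breaks the factorial
    identities, but there is no pair of distinct positions, so \<open>f\<close> vanishes.\<close>
  have trivial: "f g = 0" if "n = 1" for g
    using X that unfolding f_eq by (intro sum.neutral) fastforce
  have fact_eq: "real n * (real n - 1) * fact (n - 2) = fact n"
    "(real n - 1) * fact (n - 2) = fact (n - 1)" if n1: "n \<noteq> 1"
  proof -
    obtain m where "n = Suc (Suc m)"
      using n n1 by (cases n; cases "n - 1") auto
    then show "real n * (real n - 1) * fact (n - 2) = fact n"
      "(real n - 1) * fact (n - 2) = fact (n - 1)" by (simp_all add: algebra_simps)
  qed
  show "(\<Sum>g\<in>Sym n. f g * cdes n (inv g \<cdot> \<sigma>)) = - fact (n - 1) * f \<sigma>"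
  proof (cases "n = 1")
    case False
    have "(\<Sum>g\<in>Sym n. f g * cdes n (inv g \<cdot> \<sigma>)) = - ((real n - 1) * fact (n - 2)) * f \<sigma>"
      unfolding cdes_eq[OF n] conv_eq using n by (simp add: of_nat_diff)
    then show ?thesis
      by (simp only: fact_eq[OF False])
  qed (simp add: trivial)
  show "(\<Sum>g\<in>Sym n. f g * cmaj n (inv g \<cdot> \<sigma>)) = - (fact n / 2) * f \<sigma>"
  proof (cases "n = 1")
    case False
    have "(\<Sum>g\<in>Sym n. f g * cmaj n (inv g \<cdot> \<sigma>)) =
        - (real n * (real n - 1) * fact (n - 2) / 2) * f \<sigma>"
      unfolding cmaj_eq[OF n] conv_eq sum_positions[OF n] by simp
    then show ?thesis
      by (simp only: fact_eq[OF False])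
  qed (simp add: trivial)
qed

section \<open>Passage to the group algebra and idempotents\<close>

lemma conv_stat_elem:
  assumes "\<And>\<sigma>. \<sigma> \<in> Sym n \<Longrightarrow> (\<Sum>g\<in>Sym n. f g * h (inv g \<cdot> \<sigma>)) = c * f \<sigma>"
  shows "conv n (stat_elem n f) (stat_elem n h) = scale (complex_of_real c) (stat_elem n f)"
proof
  fix \<sigma>
  show "conv n (stat_elem n f) (stat_elem n h) \<sigma> = scale (complex_of_real c) (stat_elem n f) \<sigma>"
  proof (cases "\<sigma> \<in> Sym n")
    case True
    then have "conv n (stat_elem n f) (stat_elem n h) \<sigma> =
        complex_of_real (\<Sum>g\<in>Sym n. f g * h (inv g \<cdot> \<sigma>))"
      \<comment> \<open>Closure of \<open>Sym n\<close> keeps the second argument away from the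
        default value 0.\<close>
      by (simp add: conv_def stat_elem_def inv_perm_mult_in_Sym)
    also have "\<dots> = scale (complex_of_real c) (stat_elem n f) \<sigma>"
      using True by (simp add: assms scale_def stat_elem_def)
    finally show ?thesis .
  qed (simp add: conv_def scale_def stat_elem_def)
qed

text \<open>If \<open>u * u = c u\<close> with \<open>c \<noteq> 0\<close>, then
  \<open>u / c\<close> is idempotent, because its square is \<open>c u / c^2\<close>.\<close>

lemma idempotent_scale_stat_elem:
  assumes "conv n (stat_elem n f) (stat_elem n f) = scale c (stat_elem n f)" and "c \<noteq> 0"
  shows "\<exists>d. d \<noteq> 0 \<and> idempotent_elem n (scale d (stat_elem n f))"
proof (intro exI conjI)
  have "conv n (scale d u) (scale d u) = scale (d * d) (conv n u u)" for d u
    by (auto simp: conv_def scale_def fun_eq_iff sum_distrib_left mult_ac intro!: sum.cong)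
  then have "conv n (scale (1 / c) (stat_elem n f)) (scale (1 / c) (stat_elem n f)) =
      scale (1 / c * (1 / c)) (scale c (stat_elem n f))"
    by (simp only: assms(1))
  also have "\<dots> = scale (1 / c) (stat_elem n f)"
    using assms(2) by (simp add: scale_def)
  finally show "idempotent_elem n (scale (1 / c) (stat_elem n f))"
    by (simp add: idempotent_elem_def group_algebra_def scale_def stat_elem_def)
qed (use assms(2) in simp)

theorem corollary2:
  fixes n :: nat
  assumes "n \<ge> 1"
  shows "conv n (u_maj n) (u_des n) = scale (- fact (n - 1)) (u_maj n) \<and>
  conv n (u_maj n) (u_maj n) = scale (- (fact n / 2)) (u_maj n) \<and>
  conv n (u_des n) (u_des n) = scale (- fact (n - 1)) (u_des n) \<and>
  conv n (u_des n) (u_maj n) = scale (- (fact n / 2)) (u_des n) \<and>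
  conv n (u_inv n) (u_des n) = scale (- fact (n - 1)) (u_inv n) \<and>
  conv n (u_inv n) (u_maj n) = scale (- (fact n / 2)) (u_inv n) \<and>
  (\<forall>\<sigma>\<in>Sym n. (\<Sum>g\<in>Sym n. cmaj n g * cdes n (inv g \<cdot> \<sigma>)) = - fact (n - 1) * cmaj n \<sigma>) \<and>
  (\<forall>\<sigma>\<in>Sym n. (\<Sum>g\<in>Sym n. cmaj n g * cmaj n (inv g \<cdot> \<sigma>)) = - (fact n / 2) * cmaj n \<sigma>) \<and>
  (\<forall>\<sigma>\<in>Sym n. (\<Sum>g\<in>Sym n. cdes n g * cdes n (inv g \<cdot> \<sigma>)) = - fact (n - 1) * cdes n \<sigma>) \<and>
  (\<forall>\<sigma>\<in>Sym n. (\<Sum>g\<in>Sym n. cdes n g * cmaj n (inv g \<cdot> \<sigma>)) = - (fact n / 2) * cdes n \<sigma>) \<and>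
  (\<forall>\<sigma>\<in>Sym n. (\<Sum>g\<in>Sym n. cinv n g * cdes n (inv g \<cdot> \<sigma>)) = - fact (n - 1) * cinv n \<sigma>) \<and>
  (\<forall>\<sigma>\<in>Sym n. (\<Sum>g\<in>Sym n. cinv n g * cmaj n (inv g \<cdot> \<sigma>)) = - (fact n / 2) * cinv n \<sigma>) \<and>
  (\<exists>c. c \<noteq> 0 \<and> idempotent_elem n (scale c (u_des n))) \<and>
  (\<exists>c. c \<noteq> 0 \<and> idempotent_elem n (scale c (u_maj n)))"
proof -
  note combinations = cinv_at_combination_cdes[OF assms] cinv_at_combination_cmaj[OF assms]
    cinv_at_combination_cinv[of n]
  have des: "conv n (stat_elem n f) (u_des n) = scale (- fact (n - 1)) (stat_elem n f)"
    and maj: "conv n (stat_elem n f) (u_maj n) = scale (- (fact n / 2)) (stat_elem n f)"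
    if "cinv_at_combination n f" for f
    unfolding u_des_def u_maj_def
    using conv_stat_elem[OF combination_cdes[OF assms that]]
      conv_stat_elem[OF combination_cmaj[OF assms that]] by simp_all
  \<comment> \<open>Each of the two elements is an eigenvector for itself, with a nonzero
    eigenvalue.\<close>
  have "\<exists>c. c \<noteq> 0 \<and> idempotent_elem n (scale c (u_des n))"
    "\<exists>c. c \<noteq> 0 \<and> idempotent_elem n (scale c (u_maj n))"
    using des[OF combinations(1)] maj[OF combinations(2)] unfolding u_des_def u_maj_def
    by (auto elim!: idempotent_scale_stat_elem)
  then show ?thesis
    using des[OF combinations(1)] des[OF combinations(2)] des[OF combinations(3)]
      maj[OF combinations(1)] maj[OF combinations(2)] maj[OF combinations(3)]
      combination_cdes[OF assms combinations(1)] combination_cdes[OF assms combinations(2)]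
      combination_cdes[OF assms combinations(3)] combination_cmaj[OF assms combinations(1)]
      combination_cmaj[OF assms combinations(2)] combination_cmaj[OF assms combinations(3)]
    unfolding u_des_def[symmetric] u_maj_def[symmetric] u_inv_def[symmetric]
    by blast
qed

end
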